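(* Let $f:\mathbb{R}^n\to\mathbb{R}$ be convex. Then $f$ is differentiable almost everywhere (with respect to Lebesgue measure), and at almost every point $x$ where $f$ is differentiable there is a symmetric $n\times n$ matrix, denoted by $D^2f(x)$, such that $$\lim_{y\to x}\frac{f(y)-f(x)-Df(x)(y-x)-\frac12 (y-x)^T D^2f(x)(y-x)}{|y-x|^2}=0.$$
   Context: $Df(x)$ denotes the (linear) derivative of $f$ at $x$, so $Df(x)v=\langle\nabla f(x),v\rangle$. $D^2f(x)$ is only a name for the matrix whose existence is asserted; $f$ is not assumed to be twice differentiable in the classical sense. *)

theory Defs
  imports "HOL-Analysis.Analysis"
begin

end

theory Submission
  imports Defs
begin

text \<open>The resolvent \<open>J = (I + \<partial>f)\<^sup>-\<^sup>1\<close> of the subdifferential is everywhere defined, nonexpansive and onto,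
  so by Rademacher's theorem it is differentiable outside a null set \<open>N\<close>, and \<open>J ` N\<close> is null. By Sard's
  theorem the image of the set where its derivative is singular is null as well. At every other point
  \<open>x = J z\<close> the derivative \<open>T\<close> of \<open>J\<close> at \<open>z\<close> can be inverted, which gives the expansion
  \<open>q = p + A (y - x) + o(|y - x|)\<close>, \<open>A = T\<^sup>-\<^sup>1 - I\<close>, uniformly in \<open>q \<in> \<partial>f(y)\<close>. Integrating it along
  segments yields the second-order expansion of \<open>f\<close>; only the symmetric part of \<open>A\<close> enters it.

  In Rademacher's theorem, almost everywhere existence of one-sided directional derivatives follows from
  the one-dimensional case by Fubini. Their additivity in the direction holds after integration over
  any box, hence almost everywhere.\<close>

section \<open>Lipschitz functions of one variable\<close>

text \<open>The lower slope bound makes \<open>F\<close> injective with an increasing,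
  \<open>1/L\<close>-Lipschitz inverse. It also forces linear growth, so the intermediate value
  theorem gives surjectivity.\<close>

lemma lipschitz_homeo:
  fixes F :: "real \<Rightarrow> real"
  assumes L: "L > 0"
    and lo: "\<And>x y. x \<le> y \<Longrightarrow> L * (y - x) \<le> F y - F x"
    and hi: "\<And>x y. x \<le> y \<Longrightarrow> F y - F x \<le> C * (y - x)"
  obtains G where "\<And>x. G (F x) = x" "\<And>y. F (G y) = y" "mono G" "continuous_on UNIV G"
proof -
  have C: "C > 0" using lo[of 0 1] hi[of 0 1] L by simp
  have expand: "L * \<bar>y - x\<bar> \<le> \<bar>F y - F x\<bar>" for x y
    using lo[of x y] lo[of y x] L by (cases "x \<le> y") (auto simp: abs_if algebra_simps)
  have lip: "\<bar>F y - F x\<bar> \<le> C * \<bar>y - x\<bar>" for x y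
  proof (cases "x \<le> y")
    case True
    moreover have "0 \<le> L * (y - x)" using True L by simp
    ultimately show ?thesis using hi[of x y] lo[of x y] by simp
  next
    case False
    moreover have "0 \<le> L * (x - y)" using False L by simp
    ultimately show ?thesis using hi[of y x] lo[of y x] by simp
  qed
  have "C-lipschitz_on UNIV F"
    using lip C by (intro lipschitz_onI) (auto simp: dist_real_def)
  then have cont: "continuous_on UNIV F"
    by (rule lipschitz_on_continuous_on)
  have "\<exists>x. F x = y" for y
  proof -
    \<comment> \<open>Since \<open>L * r\<close> equals the distance from \<open>y\<close> to
      \<open>F 0\<close>, moving by \<open>r\<close> to the right or left of \<open>0\<close>
      carries \<open>F\<close> past \<open>y\<close>.\<close>
    define r where "r = \<bar>y - F 0\<bar> / L"
    have r: "r \<ge> 0" using L by (simp add: r_def)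
    have "y \<le> F r" "F (- r) \<le> y"
      using lo[of 0 r] lo[of "-r" 0] r L by (auto simp: r_def)
    then have "\<exists>x. -r \<le> x \<and> x \<le> r \<and> F x = y"
      using r cont by (intro IVT') (auto intro: continuous_on_subset)
    then show ?thesis by blast
  qed
  then obtain G where G: "\<And>y. F (G y) = y" by metis
  have GF: "G (F x) = x" for x
    using expand[of "G (F x)" x] G[of "F x"] L by (simp add: mult_le_0_iff)
  have "(1/L)-lipschitz_on UNIV G"
  proof (rule lipschitz_onI)
    fix x y
    show "dist (G x) (G y) \<le> 1 / L * dist x y"
      using expand[of "G x" "G y"] L by (simp add: G dist_real_def field_simps abs_minus_commute)
  qed (use L in simp)
  then have "continuous_on UNIV G" by (rule lipschitz_on_continuous_on)
  moreover have "mono G"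
  proof (rule monoI, rule ccontr)
    fix x y :: real assume xy: "x \<le> y" "\<not> G x \<le> G y"
    then have "L * (G x - G y) \<le> x - y" using lo[of "G y" "G x"] by (simp add: G)
    moreover have "L * (G x - G y) > 0" using xy L by simp
    ultimately show False using xy by simp
  qed
  ultimately show ?thesis using that G GF by blast
qed

text \<open>The image of Lebesgue measure under the inverse of \<open>F\<close> gives \<open>[a, b]\<close> the mass \<open>F b - F a\<close>. It is
  absolutely continuous because the Lipschitz map \<open>F\<close> preserves null sets, and its density is the integrand.\<close>

lemma bilipschitz_indefinite_integral:
  fixes F :: "real \<Rightarrow> real"
  assumes L: "L > 0"
    and lo: "\<And>x y. x \<le> y \<Longrightarrow> L * (y - x) \<le> F y - F x"
    and hi: "\<And>x y. x \<le> y \<Longrightarrow> F y - F x \<le> C * (y - x)"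
  obtains \<phi> where "\<And>a b. a \<le> b \<Longrightarrow> (\<phi> has_integral (F b - F a)) {a..b}"
proof -
  obtain G where GF: "\<And>x. G (F x) = x" and FG: "\<And>y. F (G y) = y"
    and monoG: "mono G" and contG: "continuous_on UNIV G"
    using lipschitz_homeo[of L F C] assms by blast
  have F_mono: "F x \<le> F y" if "x \<le> y" for x y
    using lo[OF that] L that mult_nonneg_nonneg[of L "y - x"] by linarith
  have G_meas [measurable]: "G \<in> borel_measurable borel"
    using contG by (rule borel_measurable_continuous_onI)
  define \<mu> where "\<mu> = distr lborel borel G"
  have sets: "sets \<mu> = sets lborel" by (simp add: \<mu>_def)
  have Gvim: "G -` A = F ` A" for A
    using GF FG by (auto simp: image_iff) metis+
  have "absolutely_continuous lborel \<mu>"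
    unfolding absolutely_continuous_def
  proof
    fix N assume N: "N \<in> null_sets (lborel :: real measure)"
    then have "negligible N"
      using completion.complete_measure_axioms null_sets_completionI
      by (auto simp: negligible_iff_null_sets)
    then have "negligible (F ` N)"
    proof (rule negligible_locally_Lipschitz_image[rotated])
      fix x
      have "\<bar>F y - F x\<bar> \<le> C * \<bar>y - x\<bar>" for y
        using hi[of x y] hi[of y x] F_mono[of x y] F_mono[of y x] by (cases "x \<le> y") auto
      then show "\<exists>T B. open T \<and> x \<in> T \<and> (\<forall>y\<in>N \<inter> T. norm (F y - F x) \<le> B * norm (y - x))"
        by (intro exI[of _ UNIV] exI[of _ C]) auto
    qed simp
    then have "G -` N \<in> null_sets lebesgue"
      by (simp add: negligible_iff_null_sets Gvim)
    moreover have "G -` N \<in> sets borel"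
      using measurable_sets[OF G_meas, of N] N by auto
    ultimately have "emeasure lborel (G -` N) = 0"
      by (auto simp: null_sets_def)
    then show "N \<in> null_sets \<mu>"
      using N by (auto simp: \<mu>_def null_sets_def emeasure_distr)
  qed
  then obtain f where f [measurable]: "f \<in> borel_measurable borel" and dens: "density lborel f = \<mu>"
    using sigma_finite_measure.Radon_Nikodym[OF sigma_finite_lborel _ sets] by auto
  have nn: "(\<integral>\<^sup>+x. f x * indicator {a..b} x \<partial>lborel) = ennreal (F b - F a)" if "a \<le> b" for a b
  proof -
    have "(\<integral>\<^sup>+x. f x * indicator {a..b} x \<partial>lborel) = emeasure \<mu> {a..b}"
      by (simp add: dens[symmetric] emeasure_density)
    also have "\<dots> = emeasure lborel (G -` {a..b})"
      by (simp add: \<mu>_def emeasure_distr)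
    also have "G -` {a..b} = {F a..F b}"
    proof
      show "G -` {a..b} \<subseteq> {F a..F b}"
        using F_mono FG by (metis atLeastAtMost_iff subsetI vimageE)
      show "{F a..F b} \<subseteq> G -` {a..b}"
        using monoG GF by (metis atLeastAtMost_iff mono_def subsetI vimageI2)
    qed
    finally show ?thesis using F_mono[OF that] by simp
  qed
  \<comment> \<open>\<open>enn2real\<close> sends infinity to \<open>0\<close>, so passing to a real
    density loses no mass only if \<open>f\<close> is finite almost everywhere.\<close>
  have fin: "AE x in lborel. f x < \<infinity>"
  proof -
    have "AE x in lborel. f x * indicator {- real n..real n} x \<noteq> \<infinity>" for n
      by (rule nn_integral_PInf_AE) (auto simp: nn)
    then have "AE x in lborel. \<forall>n. f x * indicator {- real n..real n} x \<noteq> \<infinity>"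
      by (simp add: AE_all_countable)
    then show ?thesis
    proof eventually_elim
      case (elim x)
      obtain n where "\<bar>x\<bar> \<le> real n" using real_arch_simple by blast
      then have "x \<in> {- real n..real n}" by auto
      then show ?case using elim[rule_format, of n] by (simp add: less_top)
    qed
  qed
  show ?thesis
  proof (rule that[of "\<lambda>x. enn2real (f x)"])
    fix a b :: real assume ab: "a \<le> b"
    have "(\<integral>\<^sup>+x. ennreal (enn2real (f x) * indicator {a..b} x) \<partial>lborel) = ennreal (F b - F a)"
      unfolding nn[OF ab, symmetric]
      by (rule nn_integral_cong_AE) (use fin in eventually_elim, auto simp: indicator_def less_top)
    then have "((\<lambda>x. enn2real (f x) * indicator {a..b} x) has_integral (F b - F a)) UNIV"
      using F_mono[OF ab] by (intro nn_integral_has_integral) auto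
    moreover have "(\<lambda>x. enn2real (f x) * indicator {a..b} x)
        = (\<lambda>x. if x \<in> {a..b} then enn2real (f x) else 0)"
      by (auto simp: fun_eq_iff)
    ultimately show "((\<lambda>x. enn2real (f x)) has_integral (F b - F a)) {a..b}"
      by (simp only: has_integral_restrict_UNIV)
  qed
qed

text \<open>Adding the slope \<open>L + 1\<close> makes \<open>g\<close> increase at rate at least
  \<open>1\<close>, so the sum \<open>F\<close> is an indefinite integral. Lebesgue's
  differentiation theorem for intervals with left endpoint \<open>x\<close> then gives the right
  derivative.\<close>

lemma lipschitz_AE_right_differentiable:
  fixes g :: "real \<Rightarrow> real"
  assumes lip: "\<And>x y. \<bar>g x - g y\<bar> \<le> L * \<bar>x - y\<bar>"
  shows "AE x in lborel. \<exists>l. ((\<lambda>h. (g (x + h) - g x) / h) \<longlongrightarrow> l) (at_right 0)"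
proof -
  have L: "L \<ge> 0" using lip[of 0 1] by (simp add: abs_ge_zero order_trans)
  define F where "F = (\<lambda>t. g t + (L + 1) * t)"
  have bnd: "- (L * (y - x)) \<le> g y - g x \<and> g y - g x \<le> L * (y - x)" if "x \<le> y" for x y
    using lip[of y x] that by (simp add: abs_le_iff)
  obtain \<phi> where \<phi>: "\<And>a b. a \<le> b \<Longrightarrow> (\<phi> has_integral (F b - F a)) {a..b}"
  proof (rule bilipschitz_indefinite_integral[of 1 F "2 * L + 1"])
    fix x y :: real assume "x \<le> y"
    from bnd[OF this] show "1 * (y - x) \<le> F y - F x" "F y - F x \<le> (2 * L + 1) * (y - x)"
      by (auto simp: F_def algebra_simps)
  qed auto
  obtain N where N: "negligible N" and
    lim: "\<And>x e. \<lbrakk>x \<notin> N; 0 < e\<rbrakk> \<Longrightarrow> \<exists>d>0. \<forall>h. 0 < h \<and> h < d \<longrightarrow>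
      norm (integral (cbox x (x + h *\<^sub>R One)) \<phi> /\<^sub>R h ^ DIM(real) - \<phi> x) < e"
  proof (rule integrable_ccontinuous_explicit[of \<phi>])
    fix a b :: real
    show "\<phi> integrable_on cbox a b"
      using \<phi>[of a b] by (cases "a \<le> b") (auto simp: has_integral_integrable)
  qed blast
  have *: "((\<lambda>h. (g (x + h) - g x) / h) \<longlongrightarrow> \<phi> x - (L + 1)) (at_right 0)" if xN: "x \<notin> N" for x
  proof (rule tendstoI)
    fix e :: real assume "e > 0"
    then obtain d where "d > 0" and d: "\<And>h. 0 < h \<Longrightarrow> h < d \<Longrightarrow>
      norm (integral {x..x + h} \<phi> /\<^sub>R h - \<phi> x) < e"
      using lim[OF xN, of e] by auto
    show "\<forall>\<^sub>F h in at_right 0. dist ((g (x + h) - g x) / h) (\<phi> x - (L + 1)) < e"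
      unfolding eventually_at_right_field
    proof (intro exI[of _ d] conjI allI impI)
      fix h assume h: "0 < h" "h < d"
      have "integral {x..x + h} \<phi> = F (x + h) - F x"
        using \<phi>[of x "x + h"] h by (simp add: integral_unique)
      also have "\<dots> = g (x + h) - g x + (L + 1) * h"
        by (simp add: F_def algebra_simps)
      finally have "integral {x..x + h} \<phi> /\<^sub>R h = (g (x + h) - g x) / h + (L + 1)"
        using h by (simp add: field_simps)
      then show "dist ((g (x + h) - g x) / h) (\<phi> x - (L + 1)) < e"
        using d[OF h] by (simp add: dist_real_def algebra_simps)
    qed (use \<open>d > 0\<close> in simp)
  qed
  have "AE x in lebesgue. x \<notin> N"
    using N by (simp add: negligible_iff_null_sets AE_not_in)
  then have "AE x in lborel. x \<notin> N"
    by (simp add: AE_completion_iff)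
  then show ?thesis by eventually_elim (use * in blast)
qed

section \<open>Rademacher's theorem\<close>

lemma AE_lborel_translation:
  fixes c :: "'a::euclidean_space"
  assumes P: "Measurable.pred borel P" and ae: "AE x in lborel. P (x + c)"
  shows "AE x in lborel. P x"
proof -
  have "AE x in distr lborel borel ((+) c). P x"
    using ae P by (subst AE_distr_iff) (auto simp: add.commute pred_def)
  then show ?thesis unfolding lborel_distr_plus .
qed

lemma integral_lborel_translation:
  fixes f :: "'a::euclidean_space \<Rightarrow> real"
  assumes "f \<in> borel_measurable borel"
  shows "(\<integral>x. f (x + c) \<partial>lborel) = (\<integral>x. f x \<partial>lborel)"
proof -
  have "(\<integral>x. f x \<partial>lborel) = (\<integral>x. f x \<partial>distr lborel borel ((+) c))"
    by (simp add: lborel_distr_plus)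
  also have "\<dots> = (\<integral>x. f (x + c) \<partial>lborel)"
    using assms by (subst integral_distr) (auto simp: add.commute)
  finally show ?thesis by simp
qed

text \<open>By Lebesgue's differentiation theorem, almost every value of \<open>g\<close> is the
  limit of its averages over small cubes with corner \<open>x\<close>, and these averages all
  vanish.\<close>

lemma AE_zero_if_cbox_integrals_zero:
  fixes g :: "'a::euclidean_space \<Rightarrow> real"
  assumes "\<And>a b. (g has_integral 0) (cbox a b)"
  shows "AE x in lborel. g x = 0"
proof -
  obtain N where N: "negligible N" and
    lim: "\<And>x e. \<lbrakk>x \<notin> N; 0 < e\<rbrakk> \<Longrightarrow> \<exists>d>0. \<forall>h. 0 < h \<and> h < d \<longrightarrow>
      norm (integral (cbox x (x + h *\<^sub>R One)) g /\<^sub>R h ^ DIM('a) - g x) < e"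
    using integrable_ccontinuous_explicit[of g] assms by (metis has_integral_integrable)
  have "g x = 0" if xN: "x \<notin> N" for x
  proof (rule ccontr)
    assume "g x \<noteq> 0"
    then obtain d where "d > 0" and d: "\<forall>h. 0 < h \<and> h < d \<longrightarrow>
        norm (integral (cbox x (x + h *\<^sub>R One)) g /\<^sub>R h ^ DIM('a) - g x) < \<bar>g x\<bar>"
      using lim[OF xN, of "\<bar>g x\<bar>"] by auto
    moreover have "integral (cbox x (x + (d/2) *\<^sub>R One)) g = 0"
      using assms by (rule integral_unique)
    ultimately show False using spec[OF d, of "d/2"] by simp
  qed
  moreover have "AE x in lborel. x \<notin> N"
    using N AE_not_in[of N lebesgue] by (simp add: negligible_iff_null_sets AE_completion_iff)
  ultimately show ?thesis by (auto elim: eventually_mono)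
qed

lemma pred_convergent [measurable (raw)]:
  fixes f :: "nat \<Rightarrow> 'a \<Rightarrow> real"
  assumes [measurable]: "\<And>i. f i \<in> borel_measurable M"
  shows "Measurable.pred M (\<lambda>x. convergent (\<lambda>i. f i x))"
  unfolding Cauchy_convergent_iff[symmetric] pred_def by (rule sets_Collect_Cauchy) fact

section \<open>Difference quotients along discrete steps\<close>

text \<open>The difference quotients of \<open>f\<close> at \<open>x\<close> in direction \<open>v\<close> along the steps \<open>1 / (k + 1)\<close>; for
  Lipschitz functions this sequence of steps already decides one-sided differentiability.\<close>

definition dquot :: "('a::real_vector \<Rightarrow> real) \<Rightarrow> nat \<Rightarrow> 'a \<Rightarrow> 'a \<Rightarrow> real" where
  "dquot f k v x = (f (x + (1 / real (Suc k)) *\<^sub>R v) - f x) * real (Suc k)"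

text \<open>A total function of \<open>x\<close>, so that it can be integrated. Where the quotients
  diverge, \<open>lim\<close> is unspecified; for Lipschitz \<open>f\<close> this concerns only a
  null set for each \<open>v\<close>.\<close>

definition dlim :: "('a::real_vector \<Rightarrow> real) \<Rightarrow> 'a \<Rightarrow> 'a \<Rightarrow> real" where
  "dlim f v x = lim (\<lambda>k. dquot f k v x)"

text \<open>The factor \<open>c\<close> serves positive homogeneity: the quotient in direction
  \<open>c v\<close> with step \<open>1/(k+1)\<close> is \<open>c\<close> times the quotient in
  direction \<open>v\<close> with step \<open>c/(k+1)\<close>.\<close>

lemma right_quotient_sequentially:
  fixes g :: "real \<Rightarrow> real"
  assumes "((\<lambda>t. (g t - g 0) / t) \<longlongrightarrow> l) (at_right 0)" and "c > 0"
  shows "(\<lambda>k. (g (c / real (Suc k)) - g 0) * real (Suc k)) \<longlonglongrightarrow> c * l"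
proof -
  have "filterlim (\<lambda>k. c / real (Suc k)) (at_right 0) sequentially"
    unfolding filterlim_at
  proof
    show "(\<lambda>k. c / real (Suc k)) \<longlonglongrightarrow> 0"
      using tendsto_mult[OF tendsto_const[of c] LIMSEQ_inverse_real_of_nat]
      by (simp add: divide_inverse)
  qed (use \<open>c > 0\<close> in \<open>auto intro!: always_eventually\<close>)
  from filterlim_compose[OF assms(1) this]
  have "(\<lambda>k. c * ((g (c / real (Suc k)) - g 0) / (c / real (Suc k)))) \<longlonglongrightarrow> c * l"
    by (intro tendsto_intros)
  moreover have "c * (a / (c / n)) = a * n" for a n :: real
    using \<open>c > 0\<close> by simp
  ultimately show ?thesis by (simp only:)
qed

text \<open>A step \<open>t\<close> is compared with \<open>1/n\<close>, where \<open>n\<close> is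
  the integer part of \<open>1/t\<close>. The two differ by a relative error of order
  \<open>t\<close>, so by the Lipschitz bound the quotients differ by \<open>O(t)\<close>.\<close>

lemma right_quotient_of_sequentially:
  fixes g :: "real \<Rightarrow> real"
  assumes lip: "\<And>s t. \<bar>g s - g t\<bar> \<le> L * \<bar>s - t\<bar>"
    and lim: "(\<lambda>k. (g (1 / real (Suc k)) - g 0) * real (Suc k)) \<longlonglongrightarrow> l"
  shows "((\<lambda>t. (g t - g 0) / t) \<longlongrightarrow> l) (at_right 0)"
proof -
  have L: "L \<ge> 0" using lip[of 0 1] by (simp add: abs_ge_zero order_trans)
  \<comment> \<open>The shift by one makes \<open>Suc (\<kappa> t)\<close> the integer part of
    \<open>1/t\<close>; truncated subtraction is harmless for \<open>t < 1\<close>.\<close>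
  define \<kappa> where "\<kappa> = (\<lambda>t::real. nat \<lfloor>1 / t\<rfloor> - 1)"
  have \<kappa>: "1 / t - 1 < real (Suc (\<kappa> t)) \<and> real (Suc (\<kappa> t)) \<le> 1 / t" if "0 < t" "t < 1" for t
  proof -
    have "1 \<le> \<lfloor>1 / t\<rfloor>" using that by (simp add: le_floor_iff)
    then have "Suc (\<kappa> t) = nat \<lfloor>1 / t\<rfloor>" by (simp add: \<kappa>_def)
    then have "real (Suc (\<kappa> t)) = of_int \<lfloor>1 / t\<rfloor>"
      using \<open>1 \<le> \<lfloor>1 / t\<rfloor>\<close> by (simp only: of_nat_nat)
    then show ?thesis by linarith
  qed
  have small: "\<forall>\<^sub>F t in at_right (0::real). 0 < t \<and> t < 1"
    unfolding eventually_at_right_field by (intro exI[of _ 1]) auto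
  have top: "filterlim \<kappa> sequentially (at_right 0)"
    unfolding filterlim_at_top
  proof
    fix Z :: nat
    have "\<forall>\<^sub>F t in at_right (0::real). 0 < t \<and> t < 1 / (real Z + 3)"
      unfolding eventually_at_right_field by (intro exI[of _ "1 / (real Z + 3)"]) auto
    with small show "\<forall>\<^sub>F t in at_right 0. Z \<le> \<kappa> t"
    proof eventually_elim
      case (elim t)
      then have "real Z + 3 < 1 / t" by (simp add: field_simps)
      then show ?case using \<kappa>[of t] elim by auto
    qed
  qed
  have bound: "\<bar>(g t - g 0) / t - (g (1 / real (Suc (\<kappa> t))) - g 0) * real (Suc (\<kappa> t))\<bar> \<le> 2 * L * t"
    if t: "0 < t" "t < 1/2" for t
  proof -
    define n where "n = real (Suc (\<kappa> t))"
    have n: "n \<ge> 1" "1 / t - 1 < n" "n \<le> 1 / t"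
      using \<kappa>[of t] t by (auto simp: n_def)
    have nt: "1 - t < n * t" "n * t \<le> 1" using n t by (auto simp: field_simps)
    have n': "t \<le> 1 / n" "1 / n \<le> 2 * t" using n nt t by (auto simp: field_simps)
    \<comment> \<open>One term replaces \<open>t\<close> by \<open>1/n\<close> inside
      \<open>g\<close>, the other replaces the factor \<open>1/t\<close> by \<open>n\<close>. Each
      is at most \<open>L * (1 - n * t)\<close>, and \<open>1 - n * t < t\<close>.\<close>
    have "(g t - g 0) / t - (g (1 / n) - g 0) * n
        = (g t - g (1/n)) * n + (g t - g 0) * (1 / t - n)"
      using t by (simp add: field_simps)
    also have "\<bar>\<dots>\<bar> \<le> \<bar>g t - g (1/n)\<bar> * n + \<bar>g t - g 0\<bar> * (1 / t - n)"
      using n by (intro order_trans[OF abs_triangle_ineq]) (auto simp: abs_mult)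
    also have "\<dots> \<le> L * (1 / n - t) * n + L * t * (1 / t - n)"
      using lip[of t "1/n"] lip[of t 0] n n' t
      by (intro add_mono mult_right_mono) (auto simp: abs_minus_commute)
    also have "\<dots> = L * (2 * (1 - n * t))"
      using n t by (simp add: field_simps)
    also have "\<dots> \<le> L * (2 * t)"
      using L nt by (intro mult_left_mono) auto
    finally show ?thesis by (simp add: n_def)
  qed
  have "((\<lambda>t. (g t - g 0) / t - (g (1 / real (Suc (\<kappa> t))) - g 0) * real (Suc (\<kappa> t))) \<longlongrightarrow> 0) (at_right 0)"
  proof (rule Lim_null_comparison)
    show "\<forall>\<^sub>F t in at_right 0. norm ((g t - g 0) / t - (g (1 / real (Suc (\<kappa> t))) - g 0) * real (Suc (\<kappa> t))) \<le> 2 * L * t"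
      unfolding eventually_at_right_field by (intro exI[of _ "1/2"]) (use bound in auto)
    show "((\<lambda>t. 2 * L * t) \<longlongrightarrow> 0) (at_right 0)"
      by (auto intro!: tendsto_eq_intros)
  qed
  from tendsto_add[OF this filterlim_compose[OF lim top]] show ?thesis by simp
qed

section \<open>Directional derivatives of scalar Lipschitz functions\<close>

locale real_lipschitz =
  fixes f :: "'a::euclidean_space \<Rightarrow> real" and L :: real
  assumes lip: "\<And>x y. \<bar>f x - f y\<bar> \<le> L * norm (x - y)"
begin

lemma L_nonneg: "0 \<le> L"
proof -
  obtain i :: 'a where "i \<in> Basis" using nonempty_Basis by blast
  then show ?thesis using lip[of i 0] abs_ge_zero[of "f i - f 0"] by simp
qed

lemma continuous_f: "continuous_on S f"
proof -
  have "L-lipschitz_on UNIV f"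
    by (rule lipschitz_onI) (use lip L_nonneg in \<open>auto simp: dist_real_def dist_norm\<close>)
  then show ?thesis using continuous_on_subset lipschitz_on_continuous_on by blast
qed

lemma measurable_f [measurable]: "f \<in> borel_measurable borel"
  by (rule borel_measurable_continuous_onI[OF continuous_f])

lemma measurable_dquot [measurable]: "dquot f k v \<in> borel_measurable borel"
  unfolding dquot_def[abs_def] by measurable

lemma measurable_dlim [measurable]: "dlim f v \<in> borel_measurable borel"
  unfolding dlim_def[abs_def] by measurable

lemma dquot_bound: "\<bar>dquot f k v x\<bar> \<le> L * norm v"
proof -
  have "\<bar>dquot f k v x\<bar> = \<bar>f (x + (1 / real (Suc k)) *\<^sub>R v) - f x\<bar> * real (Suc k)"
    by (simp add: dquot_def abs_mult)
  also have "\<dots> \<le> (L * norm ((1 / real (Suc k)) *\<^sub>R v)) * real (Suc k)"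
    using lip[of "x + (1 / real (Suc k)) *\<^sub>R v" x] by (intro mult_right_mono) auto
  finally show ?thesis by simp
qed

lemma lip_line: "\<bar>f (x + s *\<^sub>R v) - f (x + t *\<^sub>R v)\<bar> \<le> L * norm v * \<bar>s - t\<bar>"
  using lip[of "x + s *\<^sub>R v" "x + t *\<^sub>R v"]
  by (simp add: scaleR_diff_left[symmetric] mult_ac)

text \<open>For each \<open>x\<close>, the one-dimensional theorem on the line through
  \<open>x\<close> in direction \<open>v\<close> covers almost every \<open>t\<close>. Fubini yields
  a single \<open>t\<close> that works for almost every \<open>x\<close>, and translation invariance
  removes the shift by \<open>t v\<close>.\<close>

lemma AE_convergent_dquot: "AE x in lborel. convergent (\<lambda>k. dquot f k v x)"
proof -
  have pair: "pair_sigma_finite (lborel :: 'a measure) (lborel :: real measure)"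
    by (intro pair_sigma_finite.intro sigma_finite_lborel)
  have "AE t in lborel. convergent (\<lambda>k. dquot f k v (x + t *\<^sub>R v))" for x
  proof -
    have "AE t in lborel. \<exists>l. ((\<lambda>h. (f (x + (t + h) *\<^sub>R v) - f (x + t *\<^sub>R v)) / h) \<longlongrightarrow> l) (at_right 0)"
      using lip_line by (rule lipschitz_AE_right_differentiable)
    then show ?thesis
    proof eventually_elim
      case (elim t)
      then obtain l where "((\<lambda>h. (f (x + (t + h) *\<^sub>R v) - f (x + (t + 0) *\<^sub>R v)) / h) \<longlongrightarrow> l) (at_right 0)"
        by auto
      from right_quotient_sequentially[OF this, of 1] show ?case
        by (auto simp: dquot_def convergent_def algebra_simps)
    qed
  qed
  then have "AE x in lborel. AE t in lborel. convergent (\<lambda>k. dquot f k v (x + t *\<^sub>R v))"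
    by simp
  then have "AE t in lborel. AE x in lborel. convergent (\<lambda>k. dquot f k v (x + t *\<^sub>R v))"
    by (subst (asm) pair_sigma_finite.AE_commute[OF pair]) measurable
  then obtain t where "AE x in lborel. convergent (\<lambda>k. dquot f k v (x + t *\<^sub>R v))"
    using eventually_happens'[of "ae_filter (lborel :: real measure)"]
    by (auto simp: ae_filter_eq_bot_iff)
  then show ?thesis
    by (rule AE_lborel_translation[rotated]) measurable
qed

lemma AE_dquot_tendsto: "AE x in lborel. (\<lambda>k. dquot f k v x) \<longlonglongrightarrow> dlim f v x"
  using AE_convergent_dquot[of v] by eventually_elim (simp add: dlim_def convergent_LIMSEQ_iff)

lemma right_quotient_tendsto:
  assumes "(\<lambda>k. dquot f k v x) \<longlonglongrightarrow> l"
  shows "((\<lambda>t. (f (x + t *\<^sub>R v) - f x) / t) \<longlongrightarrow> l) (at_right 0)"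
  using right_quotient_of_sequentially[of "\<lambda>t. f (x + t *\<^sub>R v)", OF lip_line] assms
  by (simp add: dquot_def)

lemma dlim_zero: "dlim f 0 x = 0"
  by (simp add: dlim_def dquot_def limI)

text \<open>The steps \<open>c/(k+1)\<close> need not be of the form \<open>1/(m+1)\<close>, so the
  limit over all real \<open>t\<close> tending to \<open>0\<close> from the right is used.\<close>

lemma AE_dlim_scale_pos:
  assumes "c > 0"
  shows "AE x in lborel. dlim f (c *\<^sub>R v) x = c * dlim f v x"
  using AE_dquot_tendsto[of v]
proof eventually_elim
  case (elim x)
  from right_quotient_sequentially[of "\<lambda>t. f (x + t *\<^sub>R v)", OF _ assms] right_quotient_tendsto[OF elim]
  have "(\<lambda>k. dquot f k (c *\<^sub>R v) x) \<longlonglongrightarrow> c * dlim f v x"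
    by (simp add: dquot_def)
  then show ?case unfolding dlim_def[of f "c *\<^sub>R v"] by (rule limI)
qed

text \<open>Pointwise, \<open>dquot f k (u + v) x = dquot f k u x + dquot f k v (x + u / (k + 1))\<close>. The shift in
  the last term disappears in the limit after integrating over a box.\<close>

lemma integral_shifted_dquot_tendsto:
  "(\<lambda>k. \<integral>x. indicator (cbox a b) x * dquot f k v (x + (1 / real (Suc k)) *\<^sub>R u) \<partial>lborel)
     \<longlonglongrightarrow> (\<integral>x. indicator (cbox a b) x * dlim f v x \<partial>lborel)"
proof -
  define s where "s k = (1 / real (Suc k)) *\<^sub>R u" for k
  have s0: "s \<longlonglongrightarrow> 0"
    unfolding s_def using tendsto_scaleR[OF LIMSEQ_inverse_real_of_nat tendsto_const[of u]]
    by (simp add: inverse_eq_divide)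
  have snorm: "norm (s k) \<le> norm u" for k
    by (simp add: s_def divide_le_eq mult_le_cancel_left1)
  obtain R where R: "cbox a b \<subseteq> cball 0 R"
    using bounded_cbox[of a b] by (auto simp: bounded_iff subset_eq)
  \<comment> \<open>A change of variables moves the shift from the quotient to the indicator, which
    converges off the frontier of the box, a null set.\<close>
  have "(\<integral>x. indicator (cbox a b) x * dquot f k v (x + s k) \<partial>lborel)
      = (\<integral>x. indicator (cbox a b) (x - s k) * dquot f k v x \<partial>lborel)" for k
    using integral_lborel_translation[of "\<lambda>x. indicator (cbox a b) (x - s k) * dquot f k v x" "s k"]
    by simp
  moreover have "(\<lambda>k. \<integral>x. indicator (cbox a b) (x - s k) * dquot f k v x \<partial>lborel)
     \<longlonglongrightarrow> (\<integral>x. indicator (cbox a b) x * dlim f v x \<partial>lborel)"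
  proof (rule integral_dominated_convergence)
    \<comment> \<open>All the shifted boxes lie in one ball, because every shift has norm at most
      \<open>norm u\<close>.\<close>
    show "integrable lborel (\<lambda>x. indicator (cball 0 (R + norm u)) x * (L * norm v))"
      by (intro integrable_mult_left integrable_real_indicator)
         (use emeasure_lborel_cball_finite in auto)
    have "AE x in lborel. x \<notin> frontier (cbox a b)"
      using AE_not_in[of "frontier (cbox a b)" lebesgue]
        negligible_convex_frontier[of "cbox a b"]
      by (simp add: negligible_iff_null_sets AE_completion_iff)
    then show "AE x in lborel. (\<lambda>k. indicator (cbox a b) (x - s k) * dquot f k v x)
        \<longlonglongrightarrow> indicator (cbox a b) x * dlim f v x"
      using AE_dquot_tendsto[of v]
    proof eventually_elim
      case (elim x)
      have xs: "(\<lambda>k. x - s k) \<longlonglongrightarrow> x"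
        using tendsto_diff[OF tendsto_const[of x] s0] by simp
      have "\<forall>\<^sub>F k in sequentially. indicator (cbox a b) x = (indicator (cbox a b) (x - s k) :: real)"
      proof (cases "x \<in> cbox a b")
        case True
        then have "x \<in> interior (cbox a b)"
          using elim(1) by (auto simp: frontier_def closure_closed)
        then have "\<forall>\<^sub>F k in sequentially. x - s k \<in> interior (cbox a b)"
          using topological_tendstoD[OF xs open_interior] by blast
        then show ?thesis
          by eventually_elim (use True interior_subset[of "cbox a b"] in \<open>simp add: indicator_def subset_eq\<close>)
      next
        case False
        then have "\<forall>\<^sub>F k in sequentially. x - s k \<in> - cbox a b"
          using topological_tendstoD[OF xs, of "- cbox a b"] by (auto simp: closed_cbox open_Compl)
        then show ?thesis
          by eventually_elim (use False in \<open>auto simp: indicator_def\<close>)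
      qed
      from tendsto_eventually[OF this[THEN eventually_mono]]
      have "(\<lambda>k. indicator (cbox a b) (x - s k) :: real) \<longlonglongrightarrow> indicator (cbox a b) x"
        by metis
      then show ?case using elim(2) by (rule tendsto_mult)
    qed
    show "AE x in lborel. norm (indicator (cbox a b) (x - s k) * dquot f k v x)
        \<le> indicator (cball 0 (R + norm u)) x * (L * norm v)" for k
    proof (rule AE_I2)
      fix x
      show "norm (indicator (cbox a b) (x - s k) * dquot f k v x)
        \<le> indicator (cball 0 (R + norm u)) x * (L * norm v)"
      proof (cases "x - s k \<in> cbox a b")
        case True
        then have "norm (x - s k) \<le> R" using R by auto
        then have "norm x \<le> R + norm u"
          using norm_triangle_ineq[of "x - s k" "s k"] snorm[of k] by simp
        then show ?thesis using True dquot_bound by simp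
      next
        case False
        then show ?thesis using L_nonneg by simp
      qed
    qed
  qed measurable
  ultimately show ?thesis by (simp add: s_def)
qed

text \<open>The shifted quotients \<open>h k\<close> converge almost everywhere to \<open>g\<close>,
  while their box integrals converge to those of \<open>dlim f v\<close>. Hence \<open>g\<close> and
  \<open>dlim f v\<close> have equal integrals over every box.\<close>

lemma AE_dlim_add: "AE x in lborel. dlim f (u + v) x = dlim f u x + dlim f v x"
proof -
  define h where "h k x = dquot f k v (x + (1 / real (Suc k)) *\<^sub>R u)" for k x
  have [measurable]: "h k \<in> borel_measurable borel" for k
    unfolding h_def[abs_def] by measurable
  define g where "g x = dlim f (u + v) x - dlim f u x" for x
  have [measurable]: "g \<in> borel_measurable borel"
    unfolding g_def[abs_def] by measurable
  have h: "h k x = dquot f k (u + v) x - dquot f k u x" for k x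
    by (simp add: h_def dquot_def algebra_simps)
  have conv: "AE x in lborel. (\<lambda>k. h k x) \<longlonglongrightarrow> g x"
    using AE_dquot_tendsto[of "u + v"] AE_dquot_tendsto[of u]
    by eventually_elim (auto simp: h g_def intro: tendsto_diff)
  have box: "integrable lborel (\<lambda>x. indicator (cbox a b) x * (L * norm v))" for a b
    by (intro integrable_mult_left integrable_real_indicator) (use emeasure_lborel_cbox_finite in auto)
  have dom: "norm (indicator (cbox a b) x * h k x) \<le> indicator (cbox a b) x * (L * norm v)" for a b k x
    using dquot_bound by (auto simp: h_def indicator_def)
  have conv': "AE x in lborel. (\<lambda>k. indicator (cbox a b) x * h k x) \<longlonglongrightarrow> indicator (cbox a b) x * g x" for a b
    using conv by eventually_elim (auto intro: tendsto_mult)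
  have conv'': "AE x in lborel. (\<lambda>k. indicator (cbox a b) x * dquot f k v x)
      \<longlonglongrightarrow> indicator (cbox a b) x * dlim f v x" for a b
    using AE_dquot_tendsto[of v] by eventually_elim (auto intro: tendsto_mult)
  have dom'': "norm (indicator (cbox a b) x * dquot f k v x) \<le> indicator (cbox a b) x * (L * norm v)" for a b k x
    using dquot_bound by (auto simp: indicator_def)
  have "((\<lambda>x. g x - dlim f v x) has_integral 0) (cbox a b)" for a b
  proof -
    have ig: "integrable lborel (\<lambda>x. indicator (cbox a b) x * g x)"
      by (rule integrable_dominated_convergence[OF _ _ box conv' AE_I2[OF dom]]) measurable
    have id: "integrable lborel (\<lambda>x. indicator (cbox a b) x * dlim f v x)"
      by (rule integrable_dominated_convergence[OF _ _ box conv'' AE_I2[OF dom'']]) measurable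
    have "(\<lambda>k. \<integral>x. indicator (cbox a b) x * h k x \<partial>lborel) \<longlonglongrightarrow> (\<integral>x. indicator (cbox a b) x * g x \<partial>lborel)"
      by (rule integral_dominated_convergence[OF _ _ box conv' AE_I2[OF dom]]) measurable
    then have "(\<integral>x. indicator (cbox a b) x * g x \<partial>lborel) = (\<integral>x. indicator (cbox a b) x * dlim f v x \<partial>lborel)"
      using integral_shifted_dquot_tendsto[of a b v u] LIMSEQ_unique by (fastforce simp: h_def)
    then have "(\<integral>x. indicator (cbox a b) x * (g x - dlim f v x) \<partial>lborel) = 0"
      using ig id by (simp add: right_diff_distrib)
    moreover have "integrable lborel (\<lambda>x. indicator (cbox a b) x * (g x - dlim f v x))"
      using ig id by (simp add: right_diff_distrib)
    ultimately have "((\<lambda>x. indicator (cbox a b) x * (g x - dlim f v x)) has_integral 0) UNIV"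
      using has_integral_integral_lborel by metis
    moreover have "(\<lambda>x. indicator (cbox a b) x * (g x - dlim f v x))
        = (\<lambda>x. if x \<in> cbox a b then g x - dlim f v x else 0)"
      by (auto simp: fun_eq_iff)
    ultimately show ?thesis
      by (simp only: has_integral_restrict_UNIV)
  qed
  from AE_zero_if_cbox_integrals_zero[OF this] show ?thesis
    by eventually_elim (simp add: g_def)
qed

lemma AE_dlim_scale: "AE x in lborel. dlim f (c *\<^sub>R v) x = c * dlim f v x"
proof -
  consider "c > 0" | "c = 0" | "c < 0" by linarith
  then show ?thesis
  proof cases
    case 3
    \<comment> \<open>One-sided limits handle positive factors only. Additivity for \<open>v\<close>
      and \<open>- v\<close> makes \<open>dlim\<close> odd in the direction, which reverses the
      sign.\<close>
    have "AE x in lborel. dlim f ((- c) *\<^sub>R (- v)) x = - c * dlim f (- v) x"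
      using 3 by (intro AE_dlim_scale_pos) simp
    moreover have "AE x in lborel. dlim f (v + - v) x = dlim f v x + dlim f (- v) x"
      by (rule AE_dlim_add)
    ultimately show ?thesis
    proof eventually_elim
      case (elim x)
      then have "dlim f (- v) x = - dlim f v x" by (simp add: dlim_zero)
      then show ?case using elim(1) by simp
    qed
  qed (simp_all add: AE_dlim_scale_pos dlim_zero)
qed

text \<open>Finitely many uses of additivity and homogeneity on the basis expansion of
  \<open>v\<close>. The exceptional null set still depends on \<open>v\<close>.\<close>

lemma AE_dlim_eq_inner:
  "AE x in lborel. dlim f v x = (\<Sum>i\<in>Basis. dlim f i x *\<^sub>R i) \<bullet> v"
proof -
  have "AE x in lborel. dlim f (\<Sum>i\<in>B. (v \<bullet> i) *\<^sub>R i) x = (\<Sum>i\<in>B. (v \<bullet> i) * dlim f i x)"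
    if "finite B" for B
    using that
  proof (induction B)
    case empty
    then show ?case by (simp add: dlim_zero)
  next
    case (insert i B)
    from insert.IH AE_dlim_add[of "(v \<bullet> i) *\<^sub>R i" "\<Sum>i\<in>B. (v \<bullet> i) *\<^sub>R i"] AE_dlim_scale[of "v \<bullet> i" i]
    show ?case
      by eventually_elim (use insert.hyps in simp)
  qed
  from this[OF finite_Basis] have "AE x in lborel. dlim f v x = (\<Sum>i\<in>Basis. (v \<bullet> i) * dlim f i x)"
    by (simp add: euclidean_representation)
  moreover have "(\<Sum>i\<in>Basis. (v \<bullet> i) * dlim f i x) = (\<Sum>i\<in>Basis. dlim f i x *\<^sub>R i) \<bullet> v" for x
    unfolding inner_sum_left by (rule sum.cong) (auto simp: inner_commute)
  ultimately show ?thesis by simp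
qed

text \<open>By compactness, finitely many directions of \<open>V\<close> approximate the whole unit
  sphere. Their limits are uniform, and the Lipschitz bound transfers them to all nearby
  directions.\<close>

lemma has_derivative_if_dense_directions:
  assumes dense: "\<And>S. open S \<Longrightarrow> S \<noteq> {} \<Longrightarrow> \<exists>v\<in>V. v \<in> S"
    and lim: "\<And>v. v \<in> V \<Longrightarrow> ((\<lambda>t. (f (x + t *\<^sub>R v) - f x) / t) \<longlongrightarrow> G \<bullet> v) (at_right 0)"
  shows "(f has_derivative (\<lambda>h. G \<bullet> h)) (at x)"
  unfolding has_derivative_at_alt
proof (intro conjI allI impI)
  show "bounded_linear (\<lambda>h. G \<bullet> h)" by (rule bounded_linear_inner_right)
  fix e :: real assume e: "e > 0"
  \<comment> \<open>Replacing a unit vector by one within \<open>\<delta>\<close> costs at most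
    \<open>(L + norm G) * \<delta>\<close> per unit length, which stays below \<open>e / 2\<close>;
    the added \<open>1\<close> keeps the denominator positive.\<close>
  define \<delta> where "\<delta> = e / (2 * (L + norm G + 1))"
  have M: "L + norm G + 1 > 0" using L_nonneg norm_ge_zero[of G] by linarith
  then have \<delta>: "\<delta> > 0" using e by (simp add: \<delta>_def)
  have "sphere (0::'a) 1 \<subseteq> (\<Union>v\<in>V. ball v \<delta>)"
  proof
    fix w :: 'a
    obtain v where "v \<in> V" "v \<in> ball w \<delta>" using dense[of "ball w \<delta>"] \<delta> by auto
    then show "w \<in> (\<Union>v\<in>V. ball v \<delta>)" by (auto simp: dist_commute)
  qed
  then obtain W where W: "W \<subseteq> V" "finite W" "sphere 0 1 \<subseteq> (\<Union>v\<in>W. ball v \<delta>)"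
    using compactE_image[OF compact_sphere, of V "\<lambda>v. ball v \<delta>"] by (metis open_ball)
  have "\<forall>\<^sub>F t in at_right 0. \<forall>v\<in>W. dist ((f (x + t *\<^sub>R v) - f x) / t) (G \<bullet> v) < e / 2"
    using W e by (intro eventually_ball_finite ballI tendstoD lim) auto
  then obtain d where d: "d > 0" and dW: "\<And>t v. 0 < t \<Longrightarrow> t < d \<Longrightarrow> v \<in> W \<Longrightarrow>
      \<bar>(f (x + t *\<^sub>R v) - f x) / t - G \<bullet> v\<bar> < e / 2"
    unfolding eventually_at_right_field dist_real_def by blast
  show "\<exists>d>0. \<forall>y. norm (y - x) < d \<longrightarrow> norm (f y - f x - G \<bullet> (y - x)) \<le> e * norm (y - x)"
  proof (intro exI[of _ d] conjI allI impI)
    fix y assume y: "norm (y - x) < d"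
    show "norm (f y - f x - G \<bullet> (y - x)) \<le> e * norm (y - x)"
    proof (cases "y = x")
      case False
      define t where "t = norm (y - x)"
      define w where "w = (1 / t) *\<^sub>R (y - x)"
      have t: "0 < t" "t < d" using False y by (auto simp: t_def)
      have yw: "y = x + t *\<^sub>R w" using t by (simp add: w_def)
      have "w \<in> sphere 0 1" using t by (simp add: w_def) (simp add: t_def)
      then obtain v where v: "v \<in> W" "norm (w - v) < \<delta>"
        using W(3) by (force simp: dist_norm norm_minus_commute)
      have "f (x + t *\<^sub>R v) - f x - t * (G \<bullet> v) = t * ((f (x + t *\<^sub>R v) - f x) / t - G \<bullet> v)"
        using t by (simp add: field_simps)
      then have "\<bar>f (x + t *\<^sub>R v) - f x - t * (G \<bullet> v)\<bar> = t * \<bar>(f (x + t *\<^sub>R v) - f x) / t - G \<bullet> v\<bar>"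
        using t by (simp add: abs_mult)
      also have "\<dots> \<le> t * (e / 2)"
        using dW[OF t v(1)] t by (intro mult_left_mono) auto
      finally have 1: "\<bar>f (x + t *\<^sub>R v) - f x - t * (G \<bullet> v)\<bar> \<le> t * (e / 2)" .
      have "\<bar>f (x + t *\<^sub>R w) - f (x + t *\<^sub>R v)\<bar> \<le> L * (t * norm (w - v))"
        using lip[of "x + t *\<^sub>R w" "x + t *\<^sub>R v"] t by (simp flip: scaleR_diff_right)
      moreover have "\<bar>t * (G \<bullet> (w - v))\<bar> \<le> t * (norm G * norm (w - v))"
        using t Cauchy_Schwarz_ineq2[of G "w - v"] by (simp add: abs_mult)
      ultimately have "\<bar>f (x + t *\<^sub>R w) - f (x + t *\<^sub>R v)\<bar> + \<bar>t * (G \<bullet> (w - v))\<bar>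
          \<le> t * ((L + norm G) * norm (w - v))"
        by (simp add: algebra_simps)
      also have "\<dots> \<le> t * ((L + norm G + 1) * \<delta>)"
        using t M v(2) L_nonneg by (intro mult_left_mono mult_mono) auto
      also have "\<dots> = t * (e / 2)"
        using M by (simp add: \<delta>_def field_simps)
      finally have 2: "\<bar>f (x + t *\<^sub>R w) - f (x + t *\<^sub>R v)\<bar> + \<bar>t * (G \<bullet> (w - v))\<bar> \<le> t * (e / 2)" .
      have "G \<bullet> (y - x) = t * (G \<bullet> w)" by (simp add: yw)
      moreover have "t * (G \<bullet> (w - v)) = t * (G \<bullet> w) - t * (G \<bullet> v)"
        by (simp add: inner_diff_right right_diff_distrib)
      ultimately have "\<bar>f y - f x - G \<bullet> (y - x)\<bar> \<le> t * e"
        using 1 2 unfolding yw by linarith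
      then show ?thesis by (simp add: t_def mult.commute)
    qed simp
  qed (rule d)
qed

text \<open>Restricting to a countable dense set of directions lets the null sets belonging to the
  individual directions be united.\<close>

lemma AE_differentiable: "AE x in lborel. f differentiable (at x)"
proof -
  obtain V :: "'a set" where V: "countable V" "\<And>S. open S \<Longrightarrow> S \<noteq> {} \<Longrightarrow> \<exists>v\<in>V. v \<in> S"
    using countable_dense_exists by metis
  have "AE x in lborel. \<forall>v\<in>V. (\<lambda>k. dquot f k v x) \<longlonglongrightarrow> dlim f v x"
    using V(1) AE_dquot_tendsto by (simp add: AE_ball_countable)
  moreover have "AE x in lborel. \<forall>v\<in>V. dlim f v x = (\<Sum>i\<in>Basis. dlim f i x *\<^sub>R i) \<bullet> v"
    using V(1) AE_dlim_eq_inner by (simp add: AE_ball_countable)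
  ultimately show ?thesis
  proof eventually_elim
    case (elim x)
    then have "(f has_derivative (\<lambda>h. (\<Sum>i\<in>Basis. dlim f i x *\<^sub>R i) \<bullet> h)) (at x)"
      using V(2) by (intro has_derivative_if_dense_directions[of V]) (auto dest!: right_quotient_tendsto)
    then show ?case by (rule differentiableI)
  qed
qed

end

theorem Rademacher:
  fixes f :: "'a::euclidean_space \<Rightarrow> 'b::euclidean_space"
  assumes lip: "\<And>x y. norm (f x - f y) \<le> L * norm (x - y)"
  shows "AE x in lborel. f differentiable (at x)"
proof -
  have "AE x in lborel. (\<lambda>y. f y \<bullet> i) differentiable (at x)" if "i \<in> Basis" for i
  proof -
    have "\<bar>f x \<bullet> i - f y \<bullet> i\<bar> \<le> L * norm (x - y)" for x y
      using lip[of x y] Basis_le_norm[OF that, of "f x - f y"] by (simp add: inner_diff_left)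
    then interpret real_lipschitz "\<lambda>y. f y \<bullet> i" L by unfold_locales
    show ?thesis by (rule AE_differentiable)
  qed
  then have "AE x in lborel. \<forall>i\<in>Basis. (\<lambda>y. f y \<bullet> i) differentiable (at x)"
    by (simp add: AE_ball_countable countable_finite)
  then show ?thesis
    by eventually_elim (subst differentiable_componentwise_within)
qed

section \<open>Sard's theorem for arbitrary finite index types\<close>

text \<open>The library states Sard's theorem for well-ordered index types only; a copy of a finite type is
  well-ordered by an injection into the natural numbers.\<close>

typedef (overloaded) 'n wo = "UNIV :: 'n::finite set" ..

lemma UNIV_wo: "(UNIV :: 'n::finite wo set) = range Abs_wo"
  by (metis Abs_wo_cases UNIV_eq_I rangeI)

instantiation wo :: (finite) "{finite, wellorder}"
begin

definition less_eq_wo :: "'a wo \<Rightarrow> 'a wo \<Rightarrow> bool" where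
  "less_eq_wo x y \<longleftrightarrow> to_nat (Rep_wo x) \<le> to_nat (Rep_wo y)"

definition less_wo :: "'a wo \<Rightarrow> 'a wo \<Rightarrow> bool" where
  "less_wo x y \<longleftrightarrow> to_nat (Rep_wo x) < to_nat (Rep_wo y)"

instance
proof
  show "finite (UNIV :: 'a wo set)"
    by (simp add: UNIV_wo)
  fix P :: "'a wo \<Rightarrow> bool" and a
  assume step: "\<And>x. (\<And>y. y < x \<Longrightarrow> P y) \<Longrightarrow> P x"
  show "P a"
    by (induction "to_nat (Rep_wo a)" arbitrary: a rule: less_induct)
       (rule step, simp add: less_wo_def)
qed (auto simp: less_eq_wo_def less_wo_def Rep_wo_inject)

end

text \<open>Relabelling coordinates by \<open>\<phi>\<close> and \<open>\<psi>\<close> conjugates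
  \<open>f\<close> to a map on the well-ordered copy. This keeps derivatives singular, and
  \<open>\<psi>\<close> carries the null image back.\<close>

lemma Sard_singular_derivative:
  fixes f :: "real ^ 'n \<Rightarrow> real ^ 'n"
  assumes der: "\<And>x. x \<in> S \<Longrightarrow> (f has_derivative f' x) (at x)"
    and sing: "\<And>x. x \<in> S \<Longrightarrow> \<not> inj (f' x)"
  shows "negligible (f ` S)"
proof -
  define \<phi> :: "real ^ 'n \<Rightarrow> real ^ 'n wo" where "\<phi> x = (\<chi> i. x $ Rep_wo i)" for x
  define \<psi> :: "real ^ 'n wo \<Rightarrow> real ^ 'n" where "\<psi> x = (\<chi> i. x $ Abs_wo i)" for x
  have lin: "linear \<phi>" "linear \<psi>"
    by (auto simp: \<phi>_def \<psi>_def linear_iff vec_eq_iff)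
  then have bl: "bounded_linear \<phi>" "bounded_linear \<psi>"
    by (auto simp: linear_conv_bounded_linear)
  have inv [simp]: "\<phi> (\<psi> x) = x" "\<psi> (\<phi> y) = y" for x y
    by (auto simp: \<phi>_def \<psi>_def vec_eq_iff Abs_wo_inverse Rep_wo_inverse)
  define g where "g = \<phi> \<circ> f \<circ> \<psi>"
  define g' where "g' = (\<lambda>x. \<phi> \<circ> f' (\<psi> x) \<circ> \<psi>)"
  have card: "CARD('n wo) = CARD('n)"
    by (rule type_definition.card[OF type_definition_wo])
  have "negligible (g ` (\<phi> ` S))"
  proof (rule baby_Sard[where f' = g'])
    fix x assume "x \<in> \<phi> ` S"
    then have x: "\<psi> x \<in> S" by auto
    have "(\<psi> has_derivative \<psi>) (at x)"
      by (rule bounded_linear_imp_has_derivative[OF bl(2)])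
    moreover have "(\<phi> has_derivative \<phi>) (at (f (\<psi> x)))"
      by (rule bounded_linear_imp_has_derivative[OF bl(1)])
    ultimately have d: "(g has_derivative g' x) (at x)"
      unfolding g_def g'_def using der[OF x] by (auto intro!: diff_chain_at simp: comp_assoc)
    then show "(g has_derivative g' x) (at x within \<phi> ` S)"
      by (rule has_derivative_at_withinI)
    have "\<not> inj (g' x)"
    proof
      assume "inj (g' x)"
      then have "inj (f' (\<psi> x))"
        unfolding g'_def inj_def o_def by (metis inv)
      then show False using sing[OF x] by blast
    qed
    moreover have "linear (g' x)"
      using d by (simp add: has_derivative_linear)
    ultimately show "rank (matrix (g' x)) < CARD('n wo)"
      by (simp add: less_rank_noninjective matrix_works[of "g' x"])
  qed simp
  moreover have "\<psi> differentiable_on g ` (\<phi> ` S)"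
    by (rule bounded_linear_imp_differentiable_on[OF bl(2)])
  ultimately have "negligible (\<psi> ` (g ` (\<phi> ` S)))"
    by (rule negligible_differentiable_image_negligible[rotated]) (simp add: card)
  moreover have "\<psi> ` (g ` (\<phi> ` S)) = f ` S"
    by (simp add: g_def image_comp o_def)
  ultimately show ?thesis by simp
qed

section \<open>Subgradients of convex functions\<close>

definition subgradients :: "('a::real_inner \<Rightarrow> real) \<Rightarrow> 'a \<Rightarrow> 'a set" where
  "subgradients f x = {p. \<forall>y. f x + p \<bullet> (y - x) \<le> f y}"

lemma subgradientsD: "p \<in> subgradients f x \<Longrightarrow> f x + p \<bullet> (y - x) \<le> f y"
  by (simp add: subgradients_def)

lemma subgradients_monotone:
  assumes "p \<in> subgradients f x" "q \<in> subgradients f y"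
  shows "0 \<le> (q - p) \<bullet> (y - x)"
  using subgradientsD[OF assms(1), of y] subgradientsD[OF assms(2), of x]
  by (simp add: inner_diff_left inner_diff_right)

text \<open>A hyperplane separates \<open>(x, f x)\<close> from the strict epigraph
  \<open>E\<close>. Its normal \<open>(a, c)\<close> has \<open>c > 0\<close>, so it is the graph of
  an affine support function of slope \<open>- a / c\<close>.\<close>

lemma subgradients_nonempty:
  fixes f :: "'a::euclidean_space \<Rightarrow> real"
  assumes f: "convex_on UNIV f"
  shows "subgradients f x \<noteq> {}"
proof -
  define E where "E = {(y, t). f y < t}"
  have "convex E"
  proof (rule convexI)
    fix a b :: "'a \<times> real" and u v :: real
    assume ab: "a \<in> E" "b \<in> E" and uv: "0 \<le> u" "0 \<le> v" "u + v = 1"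
    obtain y s z t where [simp]: "a = (y, s)" "b = (z, t)" by (cases a, cases b)
    have "f (u *\<^sub>R y + v *\<^sub>R z) \<le> u * f y + v * f z"
      using f uv by (auto simp: convex_on_def)
    also have "\<dots> < u * s + v * t"
    proof (cases "u = 0")
      case False
      then have "u * f y < u * s" "v * f z \<le> v * t"
        using ab uv by (auto simp: E_def intro: mult_left_mono)
      then show ?thesis by simp
    qed (use ab uv in \<open>simp add: E_def\<close>)
    finally show "u *\<^sub>R a + v *\<^sub>R b \<in> E" by (simp add: E_def)
  qed
  moreover have "(x, f x + 1) \<in> E" "(x, f x) \<notin> E" by (auto simp: E_def)
  moreover from this have "E \<noteq> {}" "{(x, f x)} \<inter> E = {}" by blast+
  ultimately obtain n b where "n \<noteq> 0" and sep: "\<forall>w\<in>{(x, f x)}. n \<bullet> w \<le> b" "\<forall>w\<in>E. b \<le> n \<bullet> w"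
    using separating_hyperplane_sets[OF convex_singleton, of E "(x, f x)"] by blast
  obtain a c where n: "n = (a, c)" by (cases n)
  then have ac: "(a, c) \<noteq> 0" using \<open>n \<noteq> 0\<close> by simp
  have le: "a \<bullet> x + c * f x \<le> a \<bullet> y + c * t" if "f y < t" for y t
    using sep(1) bspec[OF sep(2), of "(y, t)"] that by (simp add: E_def n)
  have "c * f x \<le> c * (f x + 1)" using le[of x "f x + 1"] by simp
  then have "c \<ge> 0" by (simp add: algebra_simps)
  moreover have "c \<noteq> 0"
  proof
    assume "c = 0"
    \<comment> \<open>A vertical hyperplane is excluded by testing at the base point
      \<open>x - a\<close>, which would force \<open>a = 0\<close>.\<close>
    then have "a \<bullet> x \<le> a \<bullet> (x - a)" using le[of "x - a" "f (x - a) + 1"] by simp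
    then have "a \<bullet> a \<le> 0" by (simp add: inner_diff_right)
    then have "a = 0" using inner_ge_zero[of a] inner_eq_zero_iff[of a] by linarith
    then show False using ac \<open>c = 0\<close> by (simp add: zero_prod_def)
  qed
  ultimately have c: "c > 0" by simp
  have "- (1 / c) *\<^sub>R a \<in> subgradients f x"
    unfolding subgradients_def
  proof (intro CollectI allI, rule dense_ge)
    fix y t assume "f y < t"
    then have "a \<bullet> (x - y) \<le> c * (t - f x)"
      using le[of y t] by (simp add: inner_diff_right algebra_simps)
    then have "(a \<bullet> (x - y)) / c \<le> t - f x" using c by (simp add: field_simps)
    moreover have "(- (1 / c) *\<^sub>R a) \<bullet> (y - x) = (a \<bullet> (x - y)) / c"
      by (simp add: inner_diff_right diff_divide_distrib)
    ultimately show "f x + (- (1 / c) *\<^sub>R a) \<bullet> (y - x) \<le> t" by simp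
  qed
  then show ?thesis by blast
qed

section \<open>The resolvent of the subdifferential\<close>

text \<open>The minimiser \<open>x\<close> of \<open>f x + \<parallel>x - z\<parallel>\<^sup>2 / 2\<close> is the value at \<open>z\<close> of the resolvent of \<open>\<partial>f\<close>.\<close>

lemma resolvent_exists:
  fixes f :: "'a::euclidean_space \<Rightarrow> real"
  assumes f: "convex_on UNIV f"
  shows "\<exists>x. z - x \<in> subgradients f x"
proof -
  define \<phi> where "\<phi> = (\<lambda>x. f x + (norm (x - z))\<^sup>2 / 2)"
  obtain p where p: "p \<in> subgradients f z" using subgradients_nonempty[OF f] by blast
  have "continuous_on UNIV f" using convex_on_continuous[OF open_UNIV f] .
  \<comment> \<open>Outside this ball the quadratic term outweighs the affine lower bound given by
    \<open>p\<close>, so a minimiser on the ball is a global one.\<close>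
  then have "continuous_on (cball z (2 * norm p)) \<phi>"
    unfolding \<phi>_def by (auto intro!: continuous_intros intro: continuous_on_subset)
  then obtain x where x: "x \<in> cball z (2 * norm p)" "\<And>y. y \<in> cball z (2 * norm p) \<Longrightarrow> \<phi> x \<le> \<phi> y"
    using continuous_attains_inf[of "cball z (2 * norm p)" \<phi>] by fastforce
  have min: "\<phi> x \<le> \<phi> y" for y
  proof (cases "y \<in> cball z (2 * norm p)")
    case False
    define r where "r = norm (y - z)"
    have r: "2 * norm p < r" using False by (simp add: dist_norm norm_minus_commute r_def)
    have "\<phi> x \<le> \<phi> z" using x(2)[of z] by simp
    also have "\<dots> = f z" by (simp add: \<phi>_def)
    also have "\<dots> \<le> f y - p \<bullet> (y - z)" using subgradientsD[OF p, of y] by simp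
    also have "- (p \<bullet> (y - z)) \<le> norm p * r"
      using norm_cauchy_schwarz[of "- p" "y - z"] by (simp add: r_def)
    then have "f y - p \<bullet> (y - z) \<le> f y + norm p * r" by simp
    also have "\<dots> \<le> f y + r / 2 * r"
      using r by (intro add_left_mono mult_right_mono) (auto simp: r_def)
    finally show ?thesis by (simp add: \<phi>_def r_def power2_eq_square)
  qed (use x in simp)
  have "f x + (z - x) \<bullet> (y - x) \<le> f y" for y
  proof -
    define d where "d = (norm (y - x))\<^sup>2 / 2"
    \<comment> \<open>First-order optimality: minimality is compared with the point
      \<open>x + t (y - x)\<close> and divided by \<open>t\<close>, before \<open>t\<close> tends to
      \<open>0\<close>.\<close>
    have ineq: "(z - x) \<bullet> (y - x) \<le> f y - f x + t * d" if t: "0 < t" "t < 1" for t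
    proof -
      have "f (x + t *\<^sub>R (y - x)) = f ((1 - t) *\<^sub>R x + t *\<^sub>R y)" by (simp add: algebra_simps)
      also have "\<dots> \<le> (1 - t) * f x + t * f y"
        using f t by (auto simp: convex_on_def)
      finally have 1: "f (x + t *\<^sub>R (y - x)) \<le> f x + t * (f y - f x)" by (simp add: algebra_simps)
      have "(norm (x + t *\<^sub>R (y - x) - z))\<^sup>2 = (norm ((x - z) + t *\<^sub>R (y - x)))\<^sup>2"
        by (simp add: algebra_simps)
      also have "\<dots> = (norm (x - z))\<^sup>2 + 2 * t * ((x - z) \<bullet> (y - x)) + t\<^sup>2 * (norm (y - x))\<^sup>2"
        unfolding power2_norm_eq_inner
        by (simp add: inner_add_left inner_add_right inner_commute power2_eq_square)
      finally have 2: "(norm (x + t *\<^sub>R (y - x) - z))\<^sup>2 / 2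
          = (norm (x - z))\<^sup>2 / 2 + t * ((x - z) \<bullet> (y - x)) + t * (t * d)"
        by (simp add: d_def power2_eq_square add_divide_distrib)
      have "0 \<le> t * (f y - f x) + t * ((x - z) \<bullet> (y - x)) + t * (t * d)"
        using min[of "x + t *\<^sub>R (y - x)"] 1 unfolding \<phi>_def 2 by linarith
      then have "0 \<le> t * ((f y - f x) + (x - z) \<bullet> (y - x) + t * d)"
        by (simp add: distrib_left)
      then have "0 \<le> (f y - f x) + (x - z) \<bullet> (y - x) + t * d"
        using t by (simp add: zero_le_mult_iff)
      moreover have "(x - z) \<bullet> (y - x) = - ((z - x) \<bullet> (y - x))"
        by (simp add: inner_diff_left)
      ultimately show ?thesis by linarith
    qed
    have "((\<lambda>t. f y - f x + t * d) \<longlongrightarrow> f y - f x + 0 * d) (at_right 0)"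
      by (intro tendsto_intros)
    moreover have "\<forall>\<^sub>F t in at_right 0. (z - x) \<bullet> (y - x) \<le> f y - f x + t * d"
      unfolding eventually_at_right_field by (intro exI[of _ 1]) (use ineq in auto)
    ultimately have "(z - x) \<bullet> (y - x) \<le> f y - f x + 0 * d"
      by (intro tendsto_lowerbound) auto
    then show ?thesis by simp
  qed
  then show ?thesis by (auto simp: subgradients_def)
qed

lemma resolvent_firmly_nonexpansive:
  assumes "z - x \<in> subgradients f x" "w - y \<in> subgradients f y"
  shows "(norm (y - x))\<^sup>2 \<le> (w - z) \<bullet> (y - x)"
proof -
  have "0 \<le> ((w - y) - (z - x)) \<bullet> (y - x)"
    by (rule subgradients_monotone[OF assms])
  also have "(w - y) - (z - x) = (w - z) - (y - x)" by simp
  finally show ?thesis by (simp add: inner_diff_left[of "w - z"] power2_norm_eq_inner)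
qed

text \<open>Cauchy-Schwarz applied to firm nonexpansiveness. The case \<open>w = z\<close> also
  shows that the resolvent is single-valued.\<close>

lemma resolvent_nonexpansive:
  assumes "z - x \<in> subgradients f x" "w - y \<in> subgradients f y"
  shows "norm (y - x) \<le> norm (w - z)"
proof (cases "y = x")
  case False
  have "norm (y - x) * norm (y - x) \<le> norm (w - z) * norm (y - x)"
    using resolvent_firmly_nonexpansive[OF assms] norm_cauchy_schwarz[of "w - z" "y - x"]
    by (simp add: power2_eq_square)
  then show ?thesis using False by simp
qed simp

section \<open>From expansions of subgradients to expansions of the function\<close>

text \<open>Summing the subgradient inequalities over the partition of \<open>[x, x + v]\<close> into \<open>N\<close> equal pieces gives
  the Riemann sums of \<open>t * (v \<bullet> A v)\<close>, up to an error of the order of the error in the first-order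
  expansion of the subgradients.\<close>

lemma subgradient_expansion_riemann:
  fixes f :: "'a::euclidean_space \<Rightarrow> real"
  assumes ex: "\<And>y. subgradients f y \<noteq> {}" and A: "linear A"
    and q: "\<And>t q. 0 \<le> t \<Longrightarrow> t \<le> 1 \<Longrightarrow> q \<in> subgradients f (x + t *\<^sub>R v) \<Longrightarrow>
      norm (q - p - A (t *\<^sub>R v)) \<le> e * norm v"
  shows "\<bar>f (x + v) - f x - p \<bullet> v - 1 / 2 * (v \<bullet> A v)\<bar> \<le> e * (norm v)\<^sup>2"
proof -
  define a where "a = v \<bullet> A v"
  define g where "g t = f (x + t *\<^sub>R v) - t * (p \<bullet> v) - t\<^sup>2 * (a / 2)" for t
  define M where "M = e * (norm v)\<^sup>2"
  have qv: "\<bar>q \<bullet> v - p \<bullet> v - t * a\<bar> \<le> M" if "0 \<le> t" "t \<le> 1" "q \<in> subgradients f (x + t *\<^sub>R v)" for t q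
  proof -
    have "q \<bullet> v - p \<bullet> v - t * a = (q - p - A (t *\<^sub>R v)) \<bullet> v"
      using A by (simp add: a_def inner_diff_left linear_scale inner_commute[of "A v"])
    also have "\<bar>\<dots>\<bar> \<le> norm (q - p - A (t *\<^sub>R v)) * norm v" by (rule Cauchy_Schwarz_ineq2)
    also have "\<dots> \<le> (e * norm v) * norm v" using q[OF that] by (rule mult_right_mono) simp
    finally show ?thesis by (simp add: M_def power2_eq_square)
  qed
  have step: "\<bar>g t - g s\<bar> \<le> (t - s) * M + (t - s)\<^sup>2 * (\<bar>a\<bar> / 2)" if st: "0 \<le> s" "s \<le> t" "t \<le> 1" for s t
  proof -
    obtain qs qt where qs: "qs \<in> subgradients f (x + s *\<^sub>R v)" and qt: "qt \<in> subgradients f (x + t *\<^sub>R v)"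
      using ex by blast
    define h where "h = t - s"
    have h: "h \<ge> 0" "t = s + h" using st by (auto simp: h_def)
    \<comment> \<open>The subgradient at the left end bounds the increment of \<open>f\<close> from
      below, the one at the right end from above.\<close>
    have "f (x + s *\<^sub>R v) + h * (qs \<bullet> v) \<le> f (x + t *\<^sub>R v)"
      using subgradientsD[OF qs, of "x + t *\<^sub>R v"] by (simp add: h(2) scaleR_add_left)
    moreover have "f (x + t *\<^sub>R v) - h * (qt \<bullet> v) \<le> f (x + s *\<^sub>R v)"
      using subgradientsD[OF qt, of "x + s *\<^sub>R v"] by (simp add: h(2) scaleR_add_left)
    moreover have "h * (p \<bullet> v + s * a - M) \<le> h * (qs \<bullet> v)"
      using qv[OF _ _ qs] st h by (intro mult_left_mono) (auto simp: abs_le_iff)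
    moreover have "h * (qt \<bullet> v) \<le> h * (p \<bullet> v + t * a + M)"
      using qv[OF _ _ qt] st h by (intro mult_left_mono) (auto simp: abs_le_iff)
    ultimately have "g t - g s \<ge> - h * M - h\<^sup>2 * (a / 2)" "g t - g s \<le> h * M + h\<^sup>2 * (a / 2)"
      unfolding g_def h(2) by (auto simp: power2_eq_square algebra_simps)
    moreover have "\<bar>h\<^sup>2 * (a / 2)\<bar> = h\<^sup>2 * (\<bar>a\<bar> / 2)" by (simp add: abs_mult)
    ultimately have "\<bar>g t - g s\<bar> \<le> h * M + h\<^sup>2 * (\<bar>a\<bar> / 2)" by linarith
    then show ?thesis by (simp add: h_def)
  qed
  have "\<bar>g 1 - g 0\<bar> \<le> M + (\<bar>a\<bar> / 2) * (1 / real (Suc N))" for N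
  proof -
    define n where "n = real (Suc N)"
    have n: "n > 0" by (simp add: n_def)
    have "g 1 - g 0 = (\<Sum>i<Suc N. g (real (Suc i) / n) - g (real i / n))"
      using sum_lessThan_telescope[of "\<lambda>i. g (real i / n)" "Suc N"] n
      by (simp add: n_def del: sum.lessThan_Suc)
    also have "\<bar>\<dots>\<bar> \<le> (\<Sum>i<Suc N. (1 / n) * M + (1 / n)\<^sup>2 * (\<bar>a\<bar> / 2))"
    proof (rule sum_abs[THEN order_trans], rule sum_mono)
      fix i assume i: "i \<in> {..<Suc N}"
      have d: "real (Suc i) / n - real i / n = 1 / n" by (simp add: diff_divide_distrib[symmetric])
      have "real (Suc i) \<le> n" using i by (simp add: n_def)
      then show "\<bar>g (real (Suc i) / n) - g (real i / n)\<bar> \<le> (1 / n) * M + (1 / n)\<^sup>2 * (\<bar>a\<bar> / 2)"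
        using step[of "real i / n" "real (Suc i) / n"] n unfolding d by (simp add: divide_right_mono)
    qed
    also have "\<dots> = n * ((1 / n) * M + (1 / n)\<^sup>2 * (\<bar>a\<bar> / 2))" by (simp add: n_def)
    also have "\<dots> = M + (\<bar>a\<bar> / 2) * (1 / n)" using n by (simp add: field_simps power2_eq_square)
    finally show ?thesis by (simp add: n_def)
  qed
  moreover have "(\<lambda>N. M + (\<bar>a\<bar> / 2) * (1 / real (Suc N))) \<longlonglongrightarrow> M + (\<bar>a\<bar> / 2) * 0"
    using LIMSEQ_inverse_real_of_nat by (intro tendsto_intros) (simp add: inverse_eq_divide)
  ultimately have "\<bar>g 1 - g 0\<bar> \<le> M + (\<bar>a\<bar> / 2) * 0"
    by (intro LIMSEQ_le_const) auto
  then show ?thesis by (simp add: g_def a_def M_def)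
qed

text \<open>The segment estimate is applied with \<open>v = y - x\<close>. The quadratic term is of
  order \<open>norm (y - x)\<close> squared, so the same estimate also identifies \<open>p\<close>
  as the gradient.\<close>

lemma subgradients_differentiable_expansion:
  fixes f :: "'a::euclidean_space \<Rightarrow> real"
  assumes ex: "\<And>y. subgradients f y \<noteq> {}" and A: "linear A"
    and q: "\<And>e. e > 0 \<Longrightarrow> \<exists>d>0. \<forall>y q. norm (y - x) < d \<longrightarrow> q \<in> subgradients f y \<longrightarrow>
      norm (q - p - A (y - x)) \<le> e * norm (y - x)"
  shows "((\<lambda>y. (f y - f x - p \<bullet> (y - x) - 1 / 2 * ((y - x) \<bullet> A (y - x))) / (norm (y - x))\<^sup>2) \<longlongrightarrow> 0) (at x)"
    and "(f has_derivative (\<lambda>v. p \<bullet> v)) (at x)"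
proof -
  have main: "\<exists>d>0. \<forall>y. norm (y - x) < d \<longrightarrow>
      \<bar>f y - f x - p \<bullet> (y - x) - 1 / 2 * ((y - x) \<bullet> A (y - x))\<bar> \<le> e * (norm (y - x))\<^sup>2"
    if e: "e > 0" for e
  proof -
    obtain d where d: "d > 0" and dq: "\<And>y q. norm (y - x) < d \<Longrightarrow> q \<in> subgradients f y \<Longrightarrow>
        norm (q - p - A (y - x)) \<le> e * norm (y - x)"
      using q[OF e] by blast
    show ?thesis
    proof (intro exI[of _ d] conjI allI impI)
      fix y assume y: "norm (y - x) < d"
      have "\<bar>f (x + (y - x)) - f x - p \<bullet> (y - x) - 1 / 2 * ((y - x) \<bullet> A (y - x))\<bar> \<le> e * (norm (y - x))\<^sup>2"
      proof (rule subgradient_expansion_riemann[OF ex A])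
        fix t :: real and q assume t: "0 \<le> t" "t \<le> 1" and "q \<in> subgradients f (x + t *\<^sub>R (y - x))"
        moreover have le: "norm (t *\<^sub>R (y - x)) \<le> norm (y - x)"
          using t by (simp add: mult_left_le_one_le)
        ultimately have "norm (q - p - A (t *\<^sub>R (y - x))) \<le> e * norm (t *\<^sub>R (y - x))"
          using dq[of "x + t *\<^sub>R (y - x)" q] y by simp
        also have "\<dots> \<le> e * norm (y - x)" using le e by (intro mult_left_mono) auto
        finally show "norm (q - p - A (t *\<^sub>R (y - x))) \<le> e * norm (y - x)" .
      qed
      then show "\<bar>f y - f x - p \<bullet> (y - x) - 1 / 2 * ((y - x) \<bullet> A (y - x))\<bar> \<le> e * (norm (y - x))\<^sup>2"
        by simp
    qed (rule d)
  qed
  show "((\<lambda>y. (f y - f x - p \<bullet> (y - x) - 1 / 2 * ((y - x) \<bullet> A (y - x))) / (norm (y - x))\<^sup>2) \<longlongrightarrow> 0) (at x)"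
  proof (rule tendstoI)
    fix e :: real assume e: "e > 0"
    obtain d where d: "d > 0" and dy: "\<And>y. norm (y - x) < d \<Longrightarrow>
        \<bar>f y - f x - p \<bullet> (y - x) - 1 / 2 * ((y - x) \<bullet> A (y - x))\<bar> \<le> e / 2 * (norm (y - x))\<^sup>2"
      using main[of "e / 2"] e by auto
    show "\<forall>\<^sub>F y in at x. dist ((f y - f x - p \<bullet> (y - x) - 1 / 2 * ((y - x) \<bullet> A (y - x))) / (norm (y - x))\<^sup>2) 0 < e"
      unfolding eventually_at
    proof (intro exI[of _ d] conjI ballI impI)
      fix y assume y: "y \<noteq> x \<and> dist y x < d"
      then have "\<bar>f y - f x - p \<bullet> (y - x) - 1 / 2 * ((y - x) \<bullet> A (y - x))\<bar> / (norm (y - x))\<^sup>2 \<le> e / 2"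
        using dy[of y] by (subst pos_divide_le_eq) (auto simp: dist_norm)
      also have "\<dots> < e" using e by simp
      finally show "dist ((f y - f x - p \<bullet> (y - x) - 1 / 2 * ((y - x) \<bullet> A (y - x))) / (norm (y - x))\<^sup>2) 0 < e"
        by (simp add: abs_divide)
    qed (rule d)
  qed
  show "(f has_derivative (\<lambda>v. p \<bullet> v)) (at x)"
    unfolding has_derivative_at_alt
  proof (intro conjI allI impI)
    show "bounded_linear (\<lambda>v. p \<bullet> v)" by (rule bounded_linear_inner_right)
    fix e :: real assume e: "e > 0"
    obtain d where d: "d > 0" and dy: "\<And>y. norm (y - x) < d \<Longrightarrow>
        \<bar>f y - f x - p \<bullet> (y - x) - 1 / 2 * ((y - x) \<bullet> A (y - x))\<bar> \<le> 1 * (norm (y - x))\<^sup>2"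
      using main[of 1] by auto
    obtain B where B: "B > 0" "\<And>v. norm (A v) \<le> B * norm v"
      using linear_bounded_pos[OF A] by blast
    show "\<exists>d>0. \<forall>y. norm (y - x) < d \<longrightarrow> norm (f y - f x - p \<bullet> (y - x)) \<le> e * norm (y - x)"
    \<comment> \<open>With \<open>r = norm (y - x)\<close> the first-order error is at most
      \<open>(1 + B) * r * r\<close>, hence at most \<open>e * r\<close> in this range.\<close>
    proof (intro exI[of _ "min d (e / (1 + B))"] conjI allI impI)
      fix y assume y: "norm (y - x) < min d (e / (1 + B))"
      define r where "r = norm (y - x)"
      have "\<bar>(y - x) \<bullet> A (y - x)\<bar> \<le> norm (y - x) * norm (A (y - x))"
        by (rule Cauchy_Schwarz_ineq2)
      also have "\<dots> \<le> r * (B * r)" using B(2) by (simp add: r_def mult_left_mono)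
      finally have "\<bar>f y - f x - p \<bullet> (y - x)\<bar> \<le> r * r + 1 / 2 * (r * (B * r))"
        using dy[of y] y by (simp add: r_def power2_eq_square)
      also have "\<dots> \<le> (1 + B) * r * r" using B(1) by (simp add: algebra_simps)
      also have "\<dots> \<le> e * r"
        using y B(1) by (intro mult_right_mono) (auto simp: r_def field_simps)
      finally show "norm (f y - f x - p \<bullet> (y - x)) \<le> e * norm (y - x)" by (simp add: r_def)
    qed (use d e B in auto)
  qed
qed

text \<open>Firm nonexpansiveness of the resolvent \<open>J\<close> forces \<open>w\<close> to be close to \<open>z\<close> as soon as \<open>J w\<close> is close to
  \<open>J z\<close>; no compactness of the set of subgradients is needed.\<close>

lemma subgradients_expansion_of_resolvent:
  fixes f :: "'a::euclidean_space \<Rightarrow> real"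
  assumes J: "\<And>z. z - J z \<in> subgradients f (J z)"
    and der: "(J has_derivative T) (at z)" and inj: "inj T"
  shows "\<exists>A. linear A \<and> (\<forall>e>0. \<exists>d>0. \<forall>y q. norm (y - J z) < d \<longrightarrow> q \<in> subgradients f y \<longrightarrow>
      norm (q - (z - J z) - A (y - J z)) \<le> e * norm (y - J z))"
proof -
  define x where "x = J z"
  have T: "linear T" using der by (rule has_derivative_linear)
  obtain B where B: "B > 0" "\<And>v. B * norm v \<le> norm (T v)"
    using linear_inj_bounded_below_pos[OF T inj] by blast
  obtain S where S: "linear S" "\<And>v. S (T v) = v" "\<And>v. T (S v) = v"
    using linear_injective_isomorphism[OF T inj] by blast
  have approx: "\<exists>d>0. \<forall>w. norm (w - z) < d \<longrightarrow> norm (J w - x - T (w - z)) \<le> e * norm (w - z)"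
    if "e > 0" for e
    using der that unfolding has_derivative_at_alt x_def by blast
  \<comment> \<open>Uniqueness of the resolvent: every \<open>q\<close> in the subdifferential at
    \<open>y\<close> is \<open>w - J w\<close> for \<open>w = y + q\<close>, so an expansion of
    \<open>J\<close> controls all subgradients at once.\<close>
  have Jq: "J (y + q) = y" if "q \<in> subgradients f y" for y q
    using resolvent_nonexpansive[OF J[of "y + q"], of "y + q" y] that by simp
  obtain d0 where d0: "d0 > 0" and lower: "\<And>w. norm (w - z) < d0 \<Longrightarrow> B / 2 * norm (w - z) \<le> norm (J w - x)"
  proof -
    obtain d where d: "d > 0" "\<forall>w. norm (w - z) < d \<longrightarrow> norm (J w - x - T (w - z)) \<le> B / 2 * norm (w - z)"
      using approx[of "B / 2"] B by auto
    have "B / 2 * norm (w - z) \<le> norm (J w - x)" if "norm (w - z) < d" for w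
    proof -
      have "norm (T (w - z)) \<le> norm (J w - x) + norm (J w - x - T (w - z))"
        using norm_triangle_ineq4[of "J w - x" "J w - x - T (w - z)"] by simp
      then show ?thesis using B(2)[of "w - z"] d(2) that by fastforce
    qed
    with d(1) show ?thesis by (rule that)
  qed
  have near: "norm (w - z) < d0" if w: "norm (J w - x) < B\<^sup>2 * d0 / 8" for w
  proof (rule ccontr)
    assume far: "\<not> norm (w - z) < d0"
    define R where "R = norm (w - z)"
    have R: "R \<ge> d0" "R > 0" using far d0 by (auto simp: R_def)
    \<comment> \<open>The point \<open>zs\<close> lies on the segment from \<open>z\<close> to
      \<open>w\<close> at distance \<open>d0 / 2\<close> from \<open>z\<close>, where
      \<open>lower\<close> applies. Monotonicity of \<open>J\<close> along this segment transfers
      the smallness of \<open>J w - x\<close> to \<open>J zs - x\<close>.\<close>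
    define s where "s = d0 / (2 * R)"
    define zs where "zs = z + s *\<^sub>R (w - z)"
    have s: "0 < s" "s < 1" using R d0 by (auto simp: s_def field_simps)
    have nzs: "norm (zs - z) = d0 / 2" using R d0 by (simp add: zs_def s_def R_def[symmetric])
    have ws: "w - zs = (1 - s) *\<^sub>R (w - z)" by (simp add: zs_def algebra_simps)
    have "0 \<le> (w - zs) \<bullet> (J w - J zs)"
      using resolvent_firmly_nonexpansive[OF J[of zs] J[of w]] zero_le_power2 order_trans by blast
    then have "0 \<le> (w - z) \<bullet> (J w - J zs)"
      using s unfolding ws by (simp add: zero_le_mult_iff)
    then have mono: "(w - z) \<bullet> (J zs - x) \<le> (w - z) \<bullet> (J w - x)"
      by (simp add: inner_diff_right)
    have "(norm (J zs - x))\<^sup>2 \<le> (zs - z) \<bullet> (J zs - x)"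
      using resolvent_firmly_nonexpansive[OF J[of z] J[of zs]] by (simp add: x_def)
    also have "\<dots> = s * ((w - z) \<bullet> (J zs - x))" by (simp add: zs_def)
    also have "\<dots> \<le> s * ((w - z) \<bullet> (J w - x))" using mono s by simp
    also have "\<dots> \<le> s * (R * norm (J w - x))"
      using s norm_cauchy_schwarz[of "w - z" "J w - x"] by (simp add: R_def)
    also have "\<dots> = d0 / 2 * norm (J w - x)" using R by (simp add: s_def)
    \<comment> \<open>The threshold \<open>B\<^sup>2 * d0 / 8\<close> is the value that turns this
      product into the square of \<open>B * d0 / 4\<close>, contradicting \<open>lower\<close> at
      \<open>zs\<close>.\<close>
    also have "\<dots> < d0 / 2 * (B\<^sup>2 * d0 / 8)" using w d0 by simp
    also have "\<dots> = (B / 2 * (d0 / 2))\<^sup>2" by (simp add: power2_eq_square)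
    finally have "norm (J zs - x) < B / 2 * (d0 / 2)"
      by (rule power2_less_imp_less) (use B d0 in simp)
    moreover have "B / 2 * norm (zs - z) \<le> norm (J zs - x)"
      using nzs d0 by (intro lower) simp
    ultimately show False unfolding nzs by simp
  qed
  obtain C where C: "C > 0" "\<And>v. norm (S v) \<le> C * norm v"
    using linear_bounded_pos[OF S(1)] by blast
  have "\<exists>d>0. \<forall>y q. norm (y - x) < d \<longrightarrow> q \<in> subgradients f y \<longrightarrow>
      norm (q - (z - x) - (S (y - x) - (y - x))) \<le> e * norm (y - x)" if e: "e > 0" for e
  proof -
    \<comment> \<open>Inverting \<open>T\<close> costs a factor \<open>C\<close>, and returning from
      \<open>w - z\<close> to \<open>y - x\<close> costs \<open>2 / B\<close>; \<open>e'\<close>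
      absorbs both.\<close>
    define e' where "e' = e * B / (2 * C)"
    have e': "e' > 0" using e B C by (simp add: e'_def)
    obtain d1 where d1: "d1 > 0" and fine: "\<And>w. norm (w - z) < d1 \<Longrightarrow>
        norm (J w - x - T (w - z)) \<le> e' * norm (w - z)"
      using approx[OF e'] by blast
    show ?thesis
    proof (intro exI[of _ "min (B\<^sup>2 * d0 / 8) (B / 2 * d1)"] conjI allI impI)
      fix y q assume y: "norm (y - x) < min (B\<^sup>2 * d0 / 8) (B / 2 * d1)" and q: "q \<in> subgradients f y"
      define w where "w = y + q"
      have Jw: "J w = y" using Jq[OF q] by (simp add: w_def)
      have wB: "B / 2 * norm (w - z) \<le> norm (y - x)"
        using lower[OF near, of w] y by (simp add: Jw)
      also have "\<dots> < B / 2 * d1" using y by simp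
      finally have "norm (w - z) < d1" using B by simp
      then have T1: "norm (y - x - T (w - z)) \<le> e' * norm (w - z)"
        using fine[of w] by (simp add: Jw)
      have "q - (z - x) - (S (y - x) - (y - x)) = (w - z) - S (y - x)"
        by (simp add: w_def)
      also have "\<dots> = - S (y - x - T (w - z))"
        using S(1,2) by (simp add: linear_diff)
      also have "norm \<dots> \<le> C * norm (y - x - T (w - z))" using C(2) by simp
      also have "\<dots> \<le> C * (e' * norm (w - z))" using T1 C by simp
      also have "\<dots> = e * (B / 2 * norm (w - z))" using C by (simp add: e'_def)
      also have "\<dots> \<le> e * norm (y - x)" using wB e by (intro mult_left_mono) auto
      finally show "norm (q - (z - x) - (S (y - x) - (y - x))) \<le> e * norm (y - x)" .
    qed (use B d0 d1 in auto)
  qed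
  moreover have "linear (\<lambda>v. S v - v)"
    using S(1) linear_id by (intro linear_compose_sub) (auto simp: id_def)
  ultimately show ?thesis unfolding x_def by blast
qed

text \<open>A matrix and its transpose have the same quadratic form, hence so does their
  average.\<close>

lemma symmetric_matrix_of_quadratic_form:
  fixes A :: "real ^ 'n \<Rightarrow> real ^ 'n"
  assumes "linear A"
  shows "\<exists>H. transpose H = H \<and> (\<forall>v. v \<bullet> (H *v v) = v \<bullet> A v)"
proof (intro exI conjI allI)
  define M where "M = matrix A"
  let ?H = "(1 / 2) *\<^sub>R (M + transpose M)"
  show "transpose ?H = ?H"
    by (simp add: transpose_def vec_eq_iff add.commute)
  fix v
  have "v \<bullet> (transpose M *v v) = v \<bullet> (M *v v)"
    by (metis dot_lmul_matrix inner_commute transpose_matrix_vector)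
  then have "v \<bullet> (?H *v v) = v \<bullet> (M *v v)"
    by (simp add: matrix_vector_mult_add_rdistrib scaleR_matrix_vector_assoc[symmetric] inner_add_right)
  then show "v \<bullet> (?H *v v) = v \<bullet> A v"
    using assms by (simp add: M_def matrix_works)
qed

section \<open>Alexandrov's theorem\<close>

theorem theorem1p1:
  fixes f :: "real ^ 'n \<Rightarrow> real"
  assumes "convex_on UNIV f"
  shows "(AE x in lebesgue. f differentiable (at x)) \<and>
    (AE x in lebesgue. f differentiable (at x) \<longrightarrow>
      (\<exists>H :: real ^ 'n ^ 'n. transpose H = H \<and>
        ((\<lambda>y. (f y - f x - frechet_derivative f (at x) (y - x)
                 - 1 / 2 * ((y - x) \<bullet> (H *v (y - x)))) / (norm (y - x))\<^sup>2)
          \<longlongrightarrow> 0) (at x)))"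
proof -
  obtain J where J: "\<And>z. z - J z \<in> subgradients f (J z)"
    using resolvent_exists[OF assms] by metis
  have Jlip: "norm (J w - J z) \<le> 1 * norm (w - z)" for w z
    using resolvent_nonexpansive[OF J J] by simp
  define N where "N = {z. \<not> J differentiable (at z)}"
  define S where "S = {z. J differentiable (at z) \<and> \<not> inj (frechet_derivative J (at z))}"
  have "AE z in lebesgue. J differentiable (at z)"
    using Rademacher[OF Jlip] by (rule AE_completion)
  then obtain N' where "N' \<in> null_sets lebesgue" "N \<subseteq> N'"
    by (auto simp: eventually_ae_filter N_def)
  then have "negligible N"
    using negligible_iff_null_sets negligible_subset by metis
  then have "negligible (J ` N)"
    by (rule negligible_locally_Lipschitz_image[rotated]) (use Jlip in blast)+
  moreover have "negligible (J ` S)"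
    by (rule Sard_singular_derivative[where f' = "\<lambda>z. frechet_derivative J (at z)"])
       (auto simp: S_def frechet_derivative_works)
  ultimately have "negligible (J ` N \<union> J ` S)" by (rule negligible_Un)
  then have ae: "AE x in lebesgue. x \<notin> J ` N \<union> J ` S"
    unfolding negligible_iff_null_sets by (rule AE_not_in)
  have good: "f differentiable (at x) \<and>
      (\<exists>H :: real ^ 'n ^ 'n. transpose H = H \<and>
        ((\<lambda>y. (f y - f x - frechet_derivative f (at x) (y - x)
                 - 1 / 2 * ((y - x) \<bullet> (H *v (y - x)))) / (norm (y - x))\<^sup>2)
          \<longlongrightarrow> 0) (at x))"
    if x: "x \<notin> J ` N \<union> J ` S" for x
  proof -
    obtain p where p: "p \<in> subgradients f x" using subgradients_nonempty[OF assms] by blast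
    \<comment> \<open>Surjectivity of \<open>J\<close> in explicit form:
      \<open>x = J (x + p)\<close>. Thus \<open>x\<close> outside both images forces
      \<open>z\<close> outside both \<open>N\<close> and \<open>S\<close>.\<close>
    define z where "z = x + p"
    have Jz: "J z = x"
      using resolvent_nonexpansive[OF J[of z], of z x] p by (simp add: z_def)
    then have "z \<notin> N" "z \<notin> S" using x by blast+
    then have der: "(J has_derivative frechet_derivative J (at z)) (at z)"
      and inj: "inj (frechet_derivative J (at z))"
      by (auto simp: N_def S_def frechet_derivative_works)
    obtain A where A: "linear A" and exp: "\<And>e. e > 0 \<Longrightarrow> \<exists>d>0. \<forall>y q. norm (y - x) < d \<longrightarrow>
        q \<in> subgradients f y \<longrightarrow> norm (q - (z - x) - A (y - x)) \<le> e * norm (y - x)"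
      using subgradients_expansion_of_resolvent[OF J der inj] unfolding Jz by blast
    note expansion = subgradients_differentiable_expansion[OF subgradients_nonempty[OF assms] A exp]
    obtain H where H: "transpose H = H" "\<And>v. v \<bullet> (H *v v) = v \<bullet> A v"
      using symmetric_matrix_of_quadratic_form[OF A] by blast
    \<comment> \<open>Uniqueness of derivatives turns the subgradient \<open>z - x\<close> of the
      expansion into the derivative named in the theorem.\<close>
    have "frechet_derivative f (at x) = (\<lambda>v. (z - x) \<bullet> v)"
      using frechet_derivative_at[OF expansion(2)] by simp
    then show ?thesis
      using expansion H by (auto simp: differentiable_def intro!: exI[of _ H])
  qed
  show ?thesis
    unfolding AE_conj_iff[symmetric] by (rule eventually_mono[OF ae]) (use good in blast)
qed

end
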